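(* The additive group of rational numbers $\mathbb{Q}$ has a power group which is not a group of cosets of $\mathbb{Q}$.
   Context: For subsets $A, B$ of a group $G$, the subset product is $AB = \{ab \mid a \in A,\ b \in B\}$ (for additive groups, $A+B=\{a+b \mid a\in A,\ b\in B\}$). A power group of $G$ is a family $\mathcal{G} \subseteq \mathcal{P}(G) \setminus \{\emptyset\}$ of non-empty subsets of $G$ which is a group under the subset product (its identity element is some member of $\mathcal{G}$, not assumed to be $\{e\}$ or to contain the identity $e$ of $G$). Given a non-empty subset $E \subseteq G$ with $E^2 = EE = E$ and a subgroup $H$ of $G$ (possibly $H = G$) such that $aE = Ea$ for every $a \in H$, the family $\{aE \mid a \in H\}$ is a power group of $G$, satisfying $(aE)(bE) = (ab)E$ for all $a,b \in H$; it is called the group of cosets induced by $E$ and $H$. It is not required that $E$ be a subset of $H$. A power group of $G$ is called a group of cosets of $G$ if it is of this form for some such $E$ and $H$. *)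

theory Defs
  imports Complex_Main "HOL-Algebra.Algebra"
begin

text \<open>
  The identity of a power group is an arbitrary member of the family: it need be neither the
  trivial subgroup nor contain the identity of the ambient group, so it is existentially
  quantified here.
\<close>

definition power_group :: "('a, 'b) monoid_scheme \<Rightarrow> 'a set set \<Rightarrow> bool" where
  "power_group G F \<longleftrightarrow>
     F \<subseteq> Pow (carrier G) - {{}} \<and>
     (\<exists>E\<in>F. group \<lparr>carrier = F, monoid.mult = set_mult G, one = E\<rparr>)"

text \<open>
  The induced family only makes sense under the hypotheses on \<open>E\<close> and \<open>H\<close>; these are
  imposed in \<open>is_group_of_cosets\<close>. Note that \<open>E\<close> need not be a subset of \<open>H\<close>.
\<close>

definition induced_cosets :: "('a, 'b) monoid_scheme \<Rightarrow> 'a set \<Rightarrow> 'a set \<Rightarrow> 'a set set" where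
  "induced_cosets G E H = {a <#\<^bsub>G\<^esub> E | a. a \<in> H}"

definition is_group_of_cosets :: "('a, 'b) monoid_scheme \<Rightarrow> 'a set set \<Rightarrow> bool" where
  "is_group_of_cosets G F \<longleftrightarrow>
     power_group G F \<and>
     (\<exists>E H. E \<subseteq> carrier G \<and> E \<noteq> {} \<and> E <#>\<^bsub>G\<^esub> E = E \<and>
            subgroup H G \<and> (\<forall>a\<in>H. a <#\<^bsub>G\<^esub> E = E #>\<^bsub>G\<^esub> a) \<and>
            F = induced_cosets G E H)"

definition rat_group :: "rat monoid" where
  "rat_group = \<lparr>carrier = UNIV, monoid.mult = (+), one = 0\<rparr>"

lemma group_rat_group: "group rat_group"
  unfolding rat_group_def
proof (rule groupI)
  fix x :: rat
  assume "x \<in> carrier \<lparr>carrier = UNIV, monoid.mult = (+), one = 0\<rparr>"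
  show "\<exists>y\<in>carrier \<lparr>carrier = UNIV, monoid.mult = (+), one = (0::rat)\<rparr>.
          y \<otimes>\<^bsub>\<lparr>carrier = UNIV, monoid.mult = (+), one = 0\<rparr>\<^esub> x
            = \<one>\<^bsub>\<lparr>carrier = UNIV, monoid.mult = (+), one = 0\<rparr>\<^esub>"
    by (rule bexI[of _ "- x"]) auto
qed (auto simp: algebra_simps)

end

theory Submission
  imports Defs "HOL-Analysis.Continuum_Not_Denumerable"
begin

text \<open>
  The open upper rays of \<open>\<rat>\<close>, cut out by all real bounds, form a group isomorphic to the
  additive reals. In a group of cosets any two members are translates of each other by a
  rational, but two rays whose bounds differ by an irrational number are not.
\<close>

text \<open>The strict bound matters: for closed rays, irrational bounds with a rational sum would
  give a sumset missing its end point.\<close>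

definition rat_ray :: "real \<Rightarrow> rat set" where
  "rat_ray s = {q. s < of_rat q}"

lemma rat_ray_inject: "rat_ray s = rat_ray t \<longleftrightarrow> s = t"
proof
  have sub: "t \<le> s" if "rat_ray s \<subseteq> rat_ray t" for s t
  proof (rule ccontr)
    assume "\<not> t \<le> s"
    \<comment> \<open>A rational strictly between the bounds lies in only one of the rays.\<close>
    then obtain q where "s < of_rat q" "of_rat q < t"
      using of_rat_dense[of s t] by auto
    with that show False by (auto simp: rat_ray_def)
  qed
  show "s = t" if "rat_ray s = rat_ray t"
    using that by (intro antisym sub) auto
qed simp

lemma rat_ray_nonempty: "rat_ray s \<noteq> {}"
  using of_rat_dense[of s "s + 1"] by (auto simp: rat_ray_def)

lemma set_mult_rat_ray: "rat_ray s <#>\<^bsub>rat_group\<^esub> rat_ray t = rat_ray (s + t)"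
proof
  show "rat_ray s <#>\<^bsub>rat_group\<^esub> rat_ray t \<subseteq> rat_ray (s + t)"
    by (auto simp: set_mult_def rat_group_def rat_ray_def of_rat_add)
  show "rat_ray (s + t) \<subseteq> rat_ray s <#>\<^bsub>rat_group\<^esub> rat_ray t"
  proof
    fix q
    assume "q \<in> rat_ray (s + t)"
    then have "s < of_rat q - t"
      by (simp add: rat_ray_def)
    \<comment> \<open>Any rational \<open>a\<close> in this nonempty open interval splits
      \<open>q\<close> into summands \<open>a\<close> and \<open>q - a\<close> from the two
      rays.\<close>
    then obtain a where "s < of_rat a" "of_rat a < of_rat q - t"
      using of_rat_dense by blast
    then have "a \<in> rat_ray s" "q - a \<in> rat_ray t"
      by (auto simp: rat_ray_def of_rat_diff)
    moreover have "q = a + (q - a)"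
      by simp
    ultimately show "q \<in> rat_ray s <#>\<^bsub>rat_group\<^esub> rat_ray t"
      unfolding set_mult_def rat_group_def by fastforce
  qed
qed

lemma l_coset_rat_ray: "a <#\<^bsub>rat_group\<^esub> rat_ray s = rat_ray (of_rat a + s)"
proof -
  have "q \<in> (+) a ` rat_ray s" if "q \<in> rat_ray (of_rat a + s)" for q
    using that by (intro image_eqI[of _ _ "q - a"]) (auto simp: rat_ray_def of_rat_diff)
  then show ?thesis
    by (auto simp: l_coset_def rat_group_def rat_ray_def of_rat_add)
qed

lemma power_group_range_rat_ray: "power_group rat_group (range rat_ray)"
  unfolding power_group_def
proof (intro conjI bexI)
  show "range rat_ray \<subseteq> Pow (carrier rat_group) - {{}}"
    using rat_ray_nonempty by (auto simp: rat_group_def)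
  show "group \<lparr>carrier = range rat_ray, monoid.mult = set_mult rat_group, one = rat_ray 0\<rparr>"
  proof (rule groupI, goal_cases)
    \<comment> \<open>Existence of inverses: negate the bound.\<close>
    case (5 A)
    then obtain s where "A = rat_ray s" by auto
    then show ?case
      by (auto intro!: exI[of _ "- s"] simp: set_mult_rat_ray)
  qed (auto simp: set_mult_rat_ray add.assoc)
qed simp

lemma not_group_of_cosets_range_rat_ray: "\<not> is_group_of_cosets rat_group (range rat_ray)"
proof
  assume "is_group_of_cosets rat_group (range rat_ray)"
  then obtain E H where F: "range rat_ray = induced_cosets rat_group E H"
    and H: "subgroup H rat_group"
    unfolding is_group_of_cosets_def by blast
  have translate: "\<exists>a. rat_ray t = a <#\<^bsub>rat_group\<^esub> E" for t
    using rangeI[of rat_ray t] unfolding F induced_cosets_def by blast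
  \<comment> \<open>Since \<open>0\<close> lies in \<open>H\<close>, the set \<open>E\<close> is
    itself a member of the family, hence a ray.\<close>
  have "0 <#\<^bsub>rat_group\<^esub> E \<in> range rat_ray"
    unfolding F induced_cosets_def using subgroup.one_closed[OF H]
    by (auto simp: rat_group_def)
  then obtain s where E: "E = rat_ray s"
    by (auto simp: l_coset_def rat_group_def)
  \<comment> \<open>Carrying the bound \<open>s\<close> to \<open>t + s\<close> takes a translation
    by exactly \<open>t\<close>, which must therefore be rational.\<close>
  have "\<exists>a. t = of_rat a" for t :: real
    using translate[of "t + s"] by (auto simp: E l_coset_rat_ray rat_ray_inject)
  then have "(UNIV :: real set) = range of_rat"
    by auto
  then have "countable (UNIV :: real set)"
    by (metis countable_image countableI_type)
  then show False
    using uncountable_UNIV_real by contradiction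
qed

theorem theorem4:
  shows "\<exists>F :: rat set set. power_group rat_group F \<and> \<not> is_group_of_cosets rat_group F"
  using power_group_range_rat_ray not_group_of_cosets_range_rat_ray by blast

end
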